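(* For $j=1,2$ let $G_j=(V_j,E_j)$ be a (finite or infinite) connected graph on $n_j+1=|V_j|\ge 2$ vertices with a distinguished vertex $o_j\in V_j$. Assume that each $G_j$ is of QE class with QE constant $Q_j=\mathrm{QEC}(G_j)<0$. Then $$\max\{Q_1,Q_2\}\le\mathrm{QEC}(G_1\star G_2)\le Q_{12},$$ where $$Q_{12}=\frac{2Q_1Q_2}{Q_1+Q_2-\sqrt{(Q_1+Q_2)^2-\dfrac{4(n_1+n_2+1)}{(n_1+1)(n_2+1)}\,Q_1Q_2}}\,.$$ Moreover, $\max\{Q_1,Q_2\}<Q_{12}<0$.
   Context: Graphs are undirected and may be finite or infinite. For a connected graph $G=(V,E)$, $d(x,y)$ denotes the graph distance (length of a shortest path) and $D=[d(x,y)]_{x,y\in V}$ the distance matrix. $C_0(V)$ is the space of real-valued functions on $V$ with finite support, $\langle f,g\rangle=\sum_{x\in V}f(x)g(x)$, and $\langle \mathbf 1,f\rangle=\sum_{x\in V}f(x)$. The QE constant is $\mathrm{QEC}(G)=\sup\{\langle f,Df\rangle : f\in C_0(V),\ \langle f,f\rangle=1,\ \langle\mathbf 1,f\rangle=0\}$. $G$ is of QE class if there is a map $\varphi$ from $V$ into a real Hilbert space with $\|\varphi(x)-\varphi(y)\|^2=d(x,y)$ for all $x,y\in V$ (equivalently, $\mathrm{QEC}(G)\le 0$). The star product $G_1\star G_2$ is the graph obtained from the disjoint union of $G_1$ and $G_2$ by identifying the distinguished vertices $o_1$ and $o_2$. Convention for infinite graphs: if exactly one of $n_1,n_2$ is infinite,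 the formula for $Q_{12}$ is replaced by its limit as that $n_j\to\infty$; if $n_1=n_2=\infty$, then $Q_{12}$ is understood as $Q_{12}=\frac{Q_1Q_2}{Q_1+Q_2}$. *)

theory Defs
  imports "HOL-Analysis.Analysis" "HOL-Library.Extended_Real"
begin

type_synonym 'a ugraph = "'a set \<times> 'a set set"

abbreviation verts :: "'a ugraph \<Rightarrow> 'a set" where "verts G \<equiv> fst G"
abbreviation edges :: "'a ugraph \<Rightarrow> 'a set set" where "edges G \<equiv> snd G"

definition simple_graph :: "'a ugraph \<Rightarrow> bool" where
  "simple_graph G \<longleftrightarrow> verts G \<noteq> {} \<and>
     edges G \<subseteq> {{x, y} | x y. x \<in> verts G \<and> y \<in> verts G \<and> x \<noteq> y}"

text \<open>A path is given by its list of pairwise distinct vertices; its length is the number of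
  its edges, so one less than the length of the list.\<close>

definition is_path :: "'a ugraph \<Rightarrow> 'a \<Rightarrow> 'a list \<Rightarrow> 'a \<Rightarrow> bool" where
  "is_path G x p y \<longleftrightarrow> p \<noteq> [] \<and> hd p = x \<and> last p = y \<and> set p \<subseteq> verts G \<and> distinct p \<and>
     successively (\<lambda>u v. {u, v} \<in> edges G) p"

definition connected_graph :: "'a ugraph \<Rightarrow> bool" where
  "connected_graph G \<longleftrightarrow> simple_graph G \<and> (\<forall>x\<in>verts G. \<forall>y\<in>verts G. \<exists>p. is_path G x p y)"

definition graph_dist :: "'a ugraph \<Rightarrow> 'a \<Rightarrow> 'a \<Rightarrow> nat" where
  "graph_dist G x y = (LEAST n. \<exists>p. is_path G x p y \<and> length p = n + 1)"

text \<open>Real functions on \<open>V\<close> are represented by functions on the whole type; those in \<open>C0 V\<close>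
  vanish outside \<open>V\<close>. All the sums over \<open>V\<close> below have only finitely many nonzero terms when
  the function \<open>f\<close> is in \<open>C0 V\<close>.\<close>

definition C0 :: "'a set \<Rightarrow> ('a \<Rightarrow> real) set" where
  "C0 V = {f. finite {x. f x \<noteq> 0} \<and> {x. f x \<noteq> 0} \<subseteq> V}"

definition pairing :: "'a set \<Rightarrow> ('a \<Rightarrow> real) \<Rightarrow> ('a \<Rightarrow> real) \<Rightarrow> real" where
  "pairing V f g = (\<Sum>\<^sub>\<infinity>x\<in>V. f x * g x)"

definition dist_op :: "'a ugraph \<Rightarrow> ('a \<Rightarrow> real) \<Rightarrow> 'a \<Rightarrow> real" where
  "dist_op G f x = (\<Sum>\<^sub>\<infinity>y\<in>verts G. real (graph_dist G x y) * f y)"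

text \<open>The supremum is taken in the extended reals, since on an infinite graph the quadratic form
  may be unbounded above.\<close>

definition QEC :: "'a ugraph \<Rightarrow> ereal" where
  "QEC G = Sup {ereal (pairing (verts G) f (dist_op G f)) | f.
     f \<in> C0 (verts G) \<and> pairing (verts G) f f = 1 \<and> pairing (verts G) (\<lambda>_. 1) f = 0}"

text \<open>A definition cannot quantify over the Hilbert space, which is a type, so it is a parameter.
  As a hypothesis of a theorem with the type variable \<open>'h\<close> occurring nowhere else,
  \<open>QE_class TYPE('h) G\<close> says that a quadratic embedding into some real Hilbert space exists.\<close>

definition QE_class :: "'h::{real_inner, complete_space} itself \<Rightarrow> 'a ugraph \<Rightarrow> bool" where
  "QE_class _ G \<longleftrightarrow> (\<exists>\<phi> :: 'a \<Rightarrow> 'h. \<forall>x\<in>verts G. \<forall>y\<in>verts G.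
     (norm (\<phi> x - \<phi> y))\<^sup>2 = real (graph_dist G x y))"

text \<open>In the star product the vertex \<open>Inr o2\<close> of the disjoint union is replaced by \<open>Inl o1\<close>.\<close>

definition glue :: "'a \<Rightarrow> 'b \<Rightarrow> 'a + 'b \<Rightarrow> 'a + 'b" where
  "glue o1 o2 z = (if z = Inr o2 then Inl o1 else z)"

definition disjoint_union :: "'a ugraph \<Rightarrow> 'b ugraph \<Rightarrow> ('a + 'b) ugraph" where
  "disjoint_union G H =
     (Inl ` verts G \<union> Inr ` verts H, (`) Inl ` edges G \<union> (`) Inr ` edges H)"

definition star_product :: "'a ugraph \<Rightarrow> 'a \<Rightarrow> 'b ugraph \<Rightarrow> 'b \<Rightarrow> ('a + 'b) ugraph" where
  "star_product G o1 H o2 =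
     (glue o1 o2 ` verts (disjoint_union G H), (`) (glue o1 o2) ` edges (disjoint_union G H))"

definition ecard :: "'a set \<Rightarrow> enat" where
  "ecard A = (if finite A then enat (card A) else \<infinity>)"

definition Q12_finite :: "real \<Rightarrow> real \<Rightarrow> nat \<Rightarrow> nat \<Rightarrow> real" where
  "Q12_finite Q1 Q2 n1 n2 = 2 * Q1 * Q2 / (Q1 + Q2 - sqrt ((Q1 + Q2)\<^sup>2
     - 4 * (real n1 + real n2 + 1) / ((real n1 + 1) * (real n2 + 1)) * Q1 * Q2))"

definition Q12 :: "real \<Rightarrow> real \<Rightarrow> enat \<Rightarrow> enat \<Rightarrow> real" where
  "Q12 Q1 Q2 n1 n2 =
     (case n1 of
        enat k1 \<Rightarrow> (case n2 of
            enat k2 \<Rightarrow> Q12_finite Q1 Q2 k1 k2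
          | \<infinity> \<Rightarrow> lim (\<lambda>k. Q12_finite Q1 Q2 k1 k))
      | \<infinity> \<Rightarrow> (case n2 of
            enat k2 \<Rightarrow> lim (\<lambda>k. Q12_finite Q1 Q2 k k2)
          | \<infinity> \<Rightarrow> Q1 * Q2 / (Q1 + Q2)))"

end

theory Submission
  imports Defs
begin

text \<open>Subtracting \<open>d x o + d y o\<close> from \<open>d x y\<close>, where \<open>o\<close> is the common vertex, leaves the
  quadratic form unchanged on functions of sum zero, and it makes the distance matrix of the star
  product block diagonal. In invariant terms, a function \<open>f\<close> of sum zero on the star product is a
  sum \<open>f1 + f2\<close> of functions of sum zero on the factors, and its form is the sum of the forms of
  \<open>f1\<close> and \<open>f2\<close> (\<open>wedge_split_form\<close>). Extending functions by zero gives the lower bound.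

  For the upper bound, let \<open>N1\<close>, \<open>N2\<close> be the squared norms of the parts and \<open>a\<close>, \<open>b\<close> their
  values at the common vertex. The form of \<open>f\<close> is at most \<open>Q1 N1 + Q2 N2\<close>, while the squared norm
  of \<open>f\<close> is \<open>N1 + N2 + 2 a b\<close>. As the parts have sum zero, Cauchy-Schwarz bounds \<open>a\<^sup>2\<close> by \<open>c1 N1\<close>
  and \<open>b\<^sup>2\<close> by \<open>c2 N2\<close>, where \<open>cj = nj / (nj + 1)\<close>, read as \<open>1\<close> for an infinite factor
  (\<open>zero_sum_point_le\<close>). So \<open>m\<close> is an upper bound for the QE constant as soon as
  \<open>(m - Q1) N1 + (m - Q2) N2 + 2 m a b\<close> cannot be negative, and by the inequality between the
  arithmetic and the geometric mean it suffices that \<open>m \<ge> Q1, Q2\<close> and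
  \<open>(m - Q1) (m - Q2) = c1 c2 m\<^sup>2\<close>. The number \<open>Q12\<close> is the root of this quadratic equation that
  lies between \<open>max Q1 Q2\<close> and \<open>0\<close>; the limits that define it for infinite factors agree with
  the same formula at \<open>cj = 1\<close>.\<close>


section \<open>Graph distance through walks\<close>

text \<open>The graph distance is defined by paths, which are awkward to concatenate because their
  vertices have to be distinct. Walks compose freely and have the same minimal length.\<close>

inductive walk :: "'a ugraph \<Rightarrow> 'a \<Rightarrow> nat \<Rightarrow> 'a \<Rightarrow> bool" for G where
  walk_refl: "x \<in> verts G \<Longrightarrow> walk G x 0 x"
| walk_step: "walk G x n y \<Longrightarrow> {y, z} \<in> edges G \<Longrightarrow> z \<in> verts G \<Longrightarrow> walk G x (Suc n) z"

lemma walk_trans: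
  assumes "walk G y m z" "walk G x n y"
  shows "walk G x (n + m) z"
  using assms by (induction rule: walk.induct) (auto intro: walk_step)

lemma walk_map:
  assumes "walk G x n y" "f ` verts G \<subseteq> verts H" "\<And>e. e \<in> edges G \<Longrightarrow> f ` e \<in> edges H"
  shows "walk H (f x) n (f y)"
  using assms(1)
proof (induction rule: walk.induct)
  case (walk_refl x)
  then show ?case using assms(2) by (auto intro: walk.walk_refl)
next
  case (walk_step x n y z)
  have "{f y, f z} \<in> edges H" using assms(3)[OF walk_step.hyps(2)] by simp
  then show ?case using walk.walk_step[OF walk_step.IH] walk_step.hyps(3) assms(2) by auto
qed

lemma is_path_imp_walk:
  assumes "is_path G x p y"
  shows "walk G x (length p - 1) y"
proof -
  have "p \<noteq> [] \<Longrightarrow> set p \<subseteq> verts G \<Longrightarrow> successively (\<lambda>u v. {u, v} \<in> edges G) p \<Longrightarrow>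
      walk G (hd p) (length p - 1) (last p)"
  proof (induction p rule: rev_induct)
    case (snoc z p)
    show ?case
    proof (cases "p = []")
      case True
      then show ?thesis using snoc.prems by (auto intro: walk_refl)
    next
      case False
      then have "walk G (hd p) (length p - 1) (last p)" "{last p, z} \<in> edges G"
        using snoc by (auto simp: successively_append_iff)
      then have "walk G (hd p) (Suc (length p - 1)) z"
        using snoc.prems by (auto intro: walk_step)
      then show ?thesis using False by simp
    qed
  qed simp
  then show ?thesis using assms by (auto simp: is_path_def)
qed

text \<open>When a path is prolonged to a vertex that it already contains, it is cut there instead.\<close>

lemma walk_imp_is_path:
  assumes "walk G x n y"
  shows "\<exists>p. is_path G x p y \<and> length p \<le> n + 1"
  using assms
proof (induction rule: walk.induct)
  case (walk_refl x)
  then show ?case by (intro exI[of _ "[x]"]) (auto simp: is_path_def)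
next
  case (walk_step x n y z)
  then obtain p where p: "is_path G x p y" "length p \<le> n + 1" by blast
  show ?case
  proof (cases "z \<in> set p")
    case True
    then obtain as bs where "p = as @ z # bs" by (meson split_list)
    then have "is_path G x (as @ [z]) z" "length (as @ [z]) \<le> Suc n + 1"
      using p by (auto simp: is_path_def successively_append_iff hd_append split: if_splits)
    then show ?thesis by blast
  next
    case False
    then have "is_path G x (p @ [z]) z"
      using p walk_step.hyps by (auto simp: is_path_def successively_append_iff)
    then show ?thesis using p by (intro exI[of _ "p @ [z]"]) auto
  qed
qed

lemma graph_dist_le:
  assumes "walk G x n y"
  shows "graph_dist G x y \<le> n"
proof -
  obtain p where p: "is_path G x p y" "length p \<le> n + 1"
    using walk_imp_is_path[OF assms] by blast
  then have "length p = (length p - 1) + 1" by (auto simp: is_path_def Suc_leI)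
  then have "graph_dist G x y \<le> length p - 1"
    unfolding graph_dist_def using p(1) by (intro Least_le) blast
  then show ?thesis using p(2) by simp
qed

lemma walk_graph_dist:
  assumes "walk G x n y"
  shows "walk G x (graph_dist G x y) y"
proof -
  obtain p where p: "is_path G x p y" using walk_imp_is_path[OF assms] by blast
  then have "length p = (length p - 1) + 1" by (auto simp: is_path_def Suc_leI)
  then have "\<exists>n p. is_path G x p y \<and> length p = n + 1" using p by blast
  then have "\<exists>p. is_path G x p y \<and> length p = graph_dist G x y + 1"
    unfolding graph_dist_def by (rule LeastI_ex)
  then show ?thesis using is_path_imp_walk by fastforce
qed

lemma connected_walk_graph_dist:
  assumes "connected_graph G" "x \<in> verts G" "y \<in> verts G"
  shows "walk G x (graph_dist G x y) y"
proof -
  obtain p where "is_path G x p y" using assms unfolding connected_graph_def by blast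
  then show ?thesis by (rule walk_graph_dist[OF is_path_imp_walk])
qed

lemma graph_dist_self [simp]: "x \<in> verts G \<Longrightarrow> graph_dist G x x = 0"
  using graph_dist_le[OF walk_refl, of x G] by simp

lemma graph_dist_sym: "graph_dist G x y = graph_dist G y x"
proof -
  have rev: "\<exists>p. is_path G y p x \<and> length p = n"
    if "\<exists>p. is_path G x p y \<and> length p = n" for x y n
  proof -
    obtain p where "is_path G x p y" "length p = n" using \<open>\<exists>p. _\<close> by blast
    then have "is_path G y (rev p) x \<and> length (rev p) = n"
      by (auto simp: is_path_def hd_rev last_rev insert_commute)
    then show ?thesis by blast
  qed
  have "(\<exists>p. is_path G x p y \<and> length p = n) = (\<exists>p. is_path G y p x \<and> length p = n)" for n
    by (rule iffI) (erule rev)+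
  then show ?thesis unfolding graph_dist_def by simp
qed

lemma edge_endpoints:
  assumes "connected_graph G" "e \<in> edges G"
  obtains a b where "e = {a, b}" "a \<in> verts G" "b \<in> verts G"
proof -
  have "e \<in> {{x, y} | x y. x \<in> verts G \<and> y \<in> verts G \<and> x \<noteq> y}"
    using assms unfolding connected_graph_def simple_graph_def by (meson subsetD)
  then show thesis using that by blast
qed

lemma graph_dist_edge:
  assumes "connected_graph G" "x \<in> verts G" "{u, v} \<in> edges G"
  shows "graph_dist G x v \<le> graph_dist G x u + 1"
proof -
  have "u \<in> verts G" "v \<in> verts G"
    using assms(1,3) by (auto simp: connected_graph_def simple_graph_def doubleton_eq_iff)
  then show ?thesis
    using graph_dist_le[OF walk_step[OF connected_walk_graph_dist[OF assms(1,2)] assms(3)]] by simp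
qed

text \<open>This gives lower bounds for distances without any analysis of how a shortest walk runs:
  it is enough to exhibit an integer function that grows by at most one along each edge.\<close>

lemma potential_le_walk:
  fixes h :: "'a \<Rightarrow> nat"
  assumes "walk G x n y" "\<And>u v. {u, v} \<in> edges G \<Longrightarrow> h v \<le> h u + 1"
  shows "h y \<le> h x + n"
  using assms(1)
proof (induction rule: walk.induct)
  case (walk_step x n y z)
  then show ?case using assms(2)[OF walk_step.hyps(2)] by simp
qed simp


section \<open>The distance matrix of a wedge\<close>

text \<open>A wedge of two pointed graphs, given by the embeddings of the factors. Unlike the
  sum-type presentation of the star product, this form is symmetric in the two factors, so that
  facts about one of them carry over to the other.\<close>

locale wedge =
  fixes G1 :: "'a ugraph" and G2 :: "'b ugraph" and W :: "'c ugraph"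
    and o1 :: 'a and o2 :: 'b and j1 :: "'a \<Rightarrow> 'c" and j2 :: "'b \<Rightarrow> 'c"
  assumes conn1: "connected_graph G1" and conn2: "connected_graph G2"
    and o1: "o1 \<in> verts G1" and o2: "o2 \<in> verts G2"
    and inj1: "inj_on j1 (verts G1)" and inj2: "inj_on j2 (verts G2)"
    and glued: "j1 o1 = j2 o2"
    and meet: "\<And>x y. x \<in> verts G1 \<Longrightarrow> y \<in> verts G2 \<Longrightarrow> j1 x = j2 y \<Longrightarrow> x = o1 \<and> y = o2"
    and verts_W: "verts W = j1 ` verts G1 \<union> j2 ` verts G2"
    and edges_W: "edges W = (`) j1 ` edges G1 \<union> (`) j2 ` edges G2"
begin

lemma swap: "wedge G2 G1 W o2 o1 j2 j1"
  using conn1 conn2 o1 o2 inj1 inj2 glued verts_W edges_W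
  by unfold_locales (auto dest: meet[OF _ _ sym])

definition retract1 :: "'c \<Rightarrow> 'a" where
  "retract1 z = (if z \<in> j1 ` verts G1 then inv_into (verts G1) j1 z else o1)"

definition retract2 :: "'c \<Rightarrow> 'b" where
  "retract2 z = (if z \<in> j2 ` verts G2 then inv_into (verts G2) j2 z else o2)"

lemma retract_j1 [simp]:
  assumes "x \<in> verts G1"
  shows "retract1 (j1 x) = x" "retract2 (j1 x) = o2"
proof -
  show "retract1 (j1 x) = x" using assms inj1 by (auto simp: retract1_def)
  show "retract2 (j1 x) = o2" using meet[OF assms] inj2 by (auto simp: retract2_def)
qed

lemma retract_j2 [simp]:
  assumes "y \<in> verts G2"
  shows "retract2 (j2 y) = y" "retract1 (j2 y) = o1"
proof -
  show "retract2 (j2 y) = y" using assms inj2 by (auto simp: retract2_def)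
  show "retract1 (j2 y) = o1" using meet[OF _ assms sym] inj1 by (auto simp: retract1_def)
qed

text \<open>For the lower bound, the right-hand side is an integer potential in \<open>z\<close>: along an edge of
  one factor the summand of the other factor is constant, so it grows by at most one.\<close>

lemma graph_dist_wedge:
  assumes x: "x \<in> verts G1" and z: "z \<in> verts W"
  shows "graph_dist W (j1 x) z = graph_dist G1 x (retract1 z) + graph_dist G2 o2 (retract2 z)"
    (is "_ = ?h z")
proof -
  have walk1: "walk W (j1 x) (graph_dist G1 x u) (j1 u)" if "u \<in> verts G1" for u
    using walk_map[OF connected_walk_graph_dist[OF conn1 x that], of j1 W] verts_W edges_W by auto
  have walk2: "walk W (j2 o2) (graph_dist G2 o2 y) (j2 y)" if "y \<in> verts G2" for y
    using walk_map[OF connected_walk_graph_dist[OF conn2 o2 that], of j2 W] verts_W edges_W by auto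
  have walk: "walk W (j1 x) (?h z) z"
  proof (cases "z \<in> j1 ` verts G1")
    case True
    then show ?thesis using walk1 o2 by auto
  next
    case False
    then obtain y where "y \<in> verts G2" "z = j2 y" using z verts_W by auto
    then show ?thesis using walk_trans[OF walk2 walk1[OF o1, unfolded glued]] by simp
  qed
  have step: "?h v \<le> ?h u + 1" if "{u, v} \<in> edges W" for u v
  proof -
    have "{u, v} \<in> (`) j1 ` edges G1 \<or> {u, v} \<in> (`) j2 ` edges G2"
      using that unfolding edges_W by (rule UnE) simp_all
    then consider e where "e \<in> edges G1" "{u, v} = j1 ` e"
      | e where "e \<in> edges G2" "{u, v} = j2 ` e"
      by (elim disjE imageE)
    then show ?thesis
    proof cases
      case 1
      then obtain a b where e: "e = {a, b}" "a \<in> verts G1" "b \<in> verts G1"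
        using edge_endpoints[OF conn1 1(1)] by blast
      then have "u = j1 a \<and> v = j1 b \<or> u = j1 b \<and> v = j1 a"
        using 1(2) by (auto simp: doubleton_eq_iff)
      then show ?thesis
        using e 1(1) graph_dist_edge[OF conn1 x, of a b] graph_dist_edge[OF conn1 x, of b a]
        by (auto simp: insert_commute)
    next
      case 2
      then obtain a b where e: "e = {a, b}" "a \<in> verts G2" "b \<in> verts G2"
        using edge_endpoints[OF conn2 2(1)] by blast
      then have "u = j2 a \<and> v = j2 b \<or> u = j2 b \<and> v = j2 a"
        using 2(2) by (auto simp: doubleton_eq_iff)
      then show ?thesis
        using e 2(1) graph_dist_edge[OF conn2 o2, of a b] graph_dist_edge[OF conn2 o2, of b a]
        by (auto simp: insert_commute)
    qed
  qed
  have "?h z \<le> ?h (j1 x) + graph_dist W (j1 x) z"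
    using potential_le_walk[OF walk_graph_dist[OF walk], of ?h] step by blast
  then show ?thesis using graph_dist_le[OF walk] x o2 by simp
qed

lemma graph_dist_j1_j1:
  "x \<in> verts G1 \<Longrightarrow> u \<in> verts G1 \<Longrightarrow> graph_dist W (j1 x) (j1 u) = graph_dist G1 x u"
  using o2 by (subst graph_dist_wedge) (auto simp: verts_W)

lemma graph_dist_j1_j2:
  "x \<in> verts G1 \<Longrightarrow> y \<in> verts G2 \<Longrightarrow>
    graph_dist W (j1 x) (j2 y) = graph_dist G1 x o1 + graph_dist G2 o2 y"
  by (subst graph_dist_wedge) (auto simp: verts_W)

lemma graph_dist_j2_j2:
  "x \<in> verts G2 \<Longrightarrow> y \<in> verts G2 \<Longrightarrow> graph_dist W (j2 x) (j2 y) = graph_dist G2 x y"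
  by (rule wedge.graph_dist_j1_j1[OF swap])

end


section \<open>The QE constant through finite sums\<close>

definition dist_form :: "'a ugraph \<Rightarrow> 'a set \<Rightarrow> ('a \<Rightarrow> real) \<Rightarrow> real" where
  "dist_form G S f = (\<Sum>x\<in>S. f x * (\<Sum>y\<in>S. f y * real (graph_dist G x y)))"

lemma pairing_eq_sum:
  assumes "finite S" "S \<subseteq> V" "\<And>x. x \<in> V - S \<Longrightarrow> f x * g x = 0"
  shows "pairing V f g = (\<Sum>x\<in>S. f x * g x)"
proof -
  have "pairing V f g = (\<Sum>\<^sub>\<infinity>x\<in>S. f x * g x)"
    unfolding pairing_def using assms by (intro infsum_cong_neutral) auto
  then show ?thesis using assms(1) by simp
qed

lemma pairing_dist_op:
  assumes "finite S" "S \<subseteq> verts G" "\<And>x. x \<notin> S \<Longrightarrow> f x = 0"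
  shows "pairing (verts G) f (dist_op G f) = dist_form G S f"
proof -
  have "dist_op G f x = (\<Sum>y\<in>S. f y * real (graph_dist G x y))" for x
    using pairing_eq_sum[OF assms(1,2), of "\<lambda>y. real (graph_dist G x y)" f] assms(3)
    by (simp add: dist_op_def pairing_def mult.commute)
  then show ?thesis
    using pairing_eq_sum[OF assms(1,2), of f "dist_op G f"] assms(3) by (simp add: dist_form_def)
qed

text \<open>The finite set \<open>A\<close> is a convenience: the supports may be assumed to contain given
  vertices.\<close>

lemma QEC_leI:
  assumes A: "finite A" "A \<subseteq> verts G"
    and le: "\<And>S f. finite S \<Longrightarrow> A \<subseteq> S \<Longrightarrow> S \<subseteq> verts G \<Longrightarrow> sum f S = 0 \<Longrightarrow>
      dist_form G S f \<le> q * (\<Sum>x\<in>S. (f x)\<^sup>2)"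
  shows "QEC G \<le> ereal q"
  unfolding QEC_def
proof (rule Sup_least, clarify)
  fix f assume f: "f \<in> C0 (verts G)" "pairing (verts G) f f = 1" "pairing (verts G) (\<lambda>_. 1) f = 0"
  define S where "S = {x. f x \<noteq> 0} \<union> A"
  have S: "finite S" "A \<subseteq> S" "S \<subseteq> verts G" and out: "x \<notin> S \<Longrightarrow> f x = 0" for x
    using f(1) A by (auto simp: S_def C0_def)
  have "sum f S = 0" "(\<Sum>x\<in>S. (f x)\<^sup>2) = 1"
    using f(2,3) pairing_eq_sum[OF S(1,3), of f f] pairing_eq_sum[OF S(1,3), of "\<lambda>_. 1" f] out
    by (auto simp: power2_eq_square)
  then show "ereal (pairing (verts G) f (dist_op G f)) \<le> ereal q"
    using le[OF S, of f] pairing_dist_op[OF S(1,3) out] by simp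
qed

text \<open>By homogeneity, the normalisation of \<open>f\<close> can be dropped.\<close>

lemma dist_form_le_QEC:
  assumes Q: "QEC G \<le> ereal q" and S: "finite S" "S \<subseteq> verts G" and f: "sum f S = 0"
  shows "dist_form G S f \<le> q * (\<Sum>x\<in>S. (f x)\<^sup>2)"
proof (cases "(\<Sum>x\<in>S. (f x)\<^sup>2) = 0")
  case True
  then have "f x = 0" if "x \<in> S" for x
    using S(1) that by (simp add: sum_nonneg_eq_0_iff)
  then show ?thesis by (simp add: dist_form_def)
next
  case False
  define N where "N = (\<Sum>x\<in>S. (f x)\<^sup>2)"
  have N: "N > 0" using False by (auto simp: N_def sum_nonneg less_le)
  define g where "g x = (if x \<in> S then f x / sqrt N else 0)" for x
  have out: "x \<notin> S \<Longrightarrow> g x = 0" for x by (simp add: g_def)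
  have "g \<in> C0 (verts G)"
    unfolding C0_def using S by (auto simp: g_def intro: finite_subset[OF _ S(1)] split: if_splits)
  moreover have "pairing (verts G) g g = 1"
  proof -
    have "pairing (verts G) g g = (\<Sum>x\<in>S. (f x)\<^sup>2 / N)"
      using pairing_eq_sum[OF S, of g g] out N
      by (simp add: g_def power2_eq_square flip: real_sqrt_mult)
    also have "\<dots> = 1" using N by (simp add: N_def flip: sum_divide_distrib)
    finally show ?thesis .
  qed
  moreover have "pairing (verts G) (\<lambda>_. 1) g = 0"
    using pairing_eq_sum[OF S, of "\<lambda>_. 1" g] out f by (simp add: g_def flip: sum_divide_distrib)
  ultimately have "ereal (pairing (verts G) g (dist_op G g)) \<le> QEC G"
    unfolding QEC_def by (intro Sup_upper CollectI exI[of _ g] conjI refl)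
  from order_trans[OF this Q] have "dist_form G S g \<le> q"
    using pairing_dist_op[OF S out] by simp
  moreover have "dist_form G S g = dist_form G S f / N"
    using N by (simp add: dist_form_def g_def flip: sum_divide_distrib real_sqrt_mult)
  ultimately show ?thesis using N by (simp add: N_def divide_le_eq)
qed

text \<open>The value at one point is, up to sign, the sum of the others, and Cauchy-Schwarz applies
  to these. On an infinite \<open>V\<close> the factor is \<open>1\<close>, because \<open>card V = 0\<close>.\<close>

lemma zero_sum_point_le:
  fixes f :: "'a \<Rightarrow> real"
  assumes S: "finite S" "S \<subseteq> V" and v: "v \<in> S" and f: "sum f S = 0"
  shows "(f v)\<^sup>2 \<le> (1 - 1 / real (card V)) * (\<Sum>x\<in>S. (f x)\<^sup>2)"
proof -
  define N where "N = (\<Sum>x\<in>S. (f x)\<^sup>2)"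
  have card: "real (card S) = real (card (S - {v})) + 1" "card S > 0"
    using card_Suc_Diff1[OF S(1) v] by linarith+
  have "f v = - sum f (S - {v})" using f sum.remove[OF S(1) v, of f] by simp
  then have "(f v)\<^sup>2 \<le> real (card (S - {v})) * (\<Sum>x\<in>S - {v}. (f x)\<^sup>2)"
    using sum_squared_le_sum_of_squares[of f "S - {v}"] S(1) by (simp add: mult.commute)
  also have "\<dots> = real (card (S - {v})) * (N - (f v)\<^sup>2)"
    using sum.remove[OF S(1) v, of "\<lambda>x. (f x)\<^sup>2"] by (simp add: N_def)
  finally have "real (card S) * (f v)\<^sup>2 \<le> (real (card S) - 1) * N"
    using card(1) by (simp add: algebra_simps)
  then have "(f v)\<^sup>2 \<le> (1 - 1 / real (card S)) * N"
    using card(2) by (simp add: field_simps)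
  also have "\<dots> \<le> (1 - 1 / real (card V)) * N"
  proof (rule mult_right_mono)
    show "1 - 1 / real (card S) \<le> 1 - 1 / real (card V)"
    proof (cases "finite V")
      case True
      then show ?thesis using card_mono[OF True S(2)] card(2) by (simp add: frac_le)
    qed simp
    show "0 \<le> N" by (simp add: N_def sum_nonneg)
  qed
  finally show ?thesis by (simp add: N_def)
qed


section \<open>Splitting the quadratic form on a wedge\<close>

context wedge
begin

lemma QEC_le_wedge: "QEC G1 \<le> QEC W"
proof (rule ereal_le_real)
  fix q assume q: "QEC W \<le> ereal q"
  show "QEC G1 \<le> ereal q"
  proof (rule QEC_leI[of "{}"])
    fix S and f :: "'a \<Rightarrow> real"
    assume S: "finite S" "S \<subseteq> verts G1" and f: "sum f S = 0"
    have inj: "inj_on j1 S" using inj_on_subset[OF inj1 S(2)] .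
    let ?g = "\<lambda>z. f (retract1 z)"
    have sums: "(\<Sum>z\<in>j1 ` S. F (retract1 z) z) = (\<Sum>x\<in>S. F x (j1 x))"
      for F :: "'a \<Rightarrow> 'c \<Rightarrow> real"
      using S(2) by (subst sum.reindex[OF inj]) (auto intro!: sum.cong)
    have "dist_form W (j1 ` S) ?g = dist_form G1 S f"
      using S(2) graph_dist_j1_j1
      by (auto simp: dist_form_def sum.reindex[OF inj] subset_iff intro!: sum.cong)
    moreover have "sum ?g (j1 ` S) = 0" "(\<Sum>z\<in>j1 ` S. (?g z)\<^sup>2) = (\<Sum>x\<in>S. (f x)\<^sup>2)"
      using sums[of "\<lambda>x _. f x"] sums[of "\<lambda>x _. (f x)\<^sup>2"] f by auto
    moreover have "j1 ` S \<subseteq> verts W" using S(2) verts_W by auto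
    ultimately show "dist_form G1 S f \<le> q * (\<Sum>x\<in>S. (f x)\<^sup>2)"
      using dist_form_le_QEC[OF q, of "j1 ` S" ?g] S(1) by simp
  qed auto
qed

text \<open>Off the common vertex the parts keep the values of \<open>f\<close>; at the common vertex each of them
  takes the value that makes its own sum vanish, and these two values add up to that of \<open>f\<close>
  because \<open>f\<close> has sum zero. Testing against an arbitrary \<open>h\<close> expresses \<open>f = f1 + f2\<close> in the form
  in which it is applied, twice, to the quadratic form and once to the norm.\<close>

lemma zero_sum_split:
  fixes f :: "'c \<Rightarrow> real"
  assumes S: "finite S" "j1 o1 \<in> S" "S \<subseteq> verts W" and f: "sum f S = 0"
  obtains S1 S2 f1 f2 where "finite S1" "S1 \<subseteq> verts G1" "o1 \<in> S1" "sum f1 S1 = 0"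
    and "finite S2" "S2 \<subseteq> verts G2" "o2 \<in> S2" "sum f2 S2 = 0"
    and "\<And>x. x \<in> S1 \<Longrightarrow> x \<noteq> o1 \<Longrightarrow> f (j1 x) = f1 x"
    and "\<And>y. y \<in> S2 \<Longrightarrow> y \<noteq> o2 \<Longrightarrow> f (j2 y) = f2 y"
    and "f (j1 o1) = f1 o1 + f2 o2"
    and "\<And>h :: 'c \<Rightarrow> real. (\<Sum>z\<in>S. f z * h z) =
      (\<Sum>x\<in>S1. f1 x * h (j1 x)) + (\<Sum>y\<in>S2. f2 y * h (j2 y))"
proof -
  define S1 where "S1 = {x \<in> verts G1. j1 x \<in> S}"
  define S2 where "S2 = {y \<in> verts G2. j2 y \<in> S}"
  define T1 where "T1 = S1 - {o1}"
  define T2 where "T2 = S2 - {o2}"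
  define f1 where "f1 x = (if x = o1 then - (\<Sum>x\<in>T1. f (j1 x)) else f (j1 x))" for x
  define f2 where "f2 y = (if y = o2 then - (\<Sum>y\<in>T2. f (j2 y)) else f (j2 y))" for y
  have inj: "inj_on j1 S1" "inj_on j2 S2" "inj_on j1 T1" "inj_on j2 T2"
    using inj1 inj2 by (auto simp: S1_def S2_def T1_def T2_def inj_on_def)
  have "j1 ` S1 \<subseteq> S" "j2 ` S2 \<subseteq> S" by (auto simp: S1_def S2_def)
  then have fin: "finite S1" "finite S2"
    using S(1) inj(1,2) by (meson finite_imageD finite_subset)+
  then have finT: "finite T1" "finite T2" by (auto simp: T1_def T2_def)
  have mem: "o1 \<in> S1" "o2 \<in> S2" using S(2) o1 o2 glued by (auto simp: S1_def S2_def)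
  have S_eq: "S = insert (j1 o1) (j1 ` T1 \<union> j2 ` T2)"
  proof -
    have "S = j1 ` S1 \<union> j2 ` S2" using S(3) verts_W by (auto simp: S1_def S2_def)
    then show ?thesis using mem glued by (auto simp: T1_def T2_def)
  qed
  have notin: "j1 o1 \<notin> j1 ` T1 \<union> j2 ` T2"
  proof
    assume "j1 o1 \<in> j1 ` T1 \<union> j2 ` T2"
    then show False
      using inj_onD[OF inj1 _ o1] meet[OF o1] by (auto simp: T1_def T2_def S1_def S2_def)
  qed
  have disj: "j1 ` T1 \<inter> j2 ` T2 = {}"
    using meet by (fastforce simp: T1_def T2_def S1_def S2_def)
  have sum_S: "(\<Sum>z\<in>S. k z) = k (j1 o1) + (\<Sum>x\<in>T1. k (j1 x)) + (\<Sum>y\<in>T2. k (j2 y))"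
    for k :: "'c \<Rightarrow> real"
    unfolding S_eq using finT notin disj
    by (simp add: sum.union_disjoint sum.reindex[OF inj(3)] sum.reindex[OF inj(4)])
  have sum_1: "(\<Sum>x\<in>S1. f1 x * k x) = f1 o1 * k o1 + (\<Sum>x\<in>T1. f (j1 x) * k x)" for k
    using sum.remove[OF fin(1) mem(1), of "\<lambda>x. f1 x * k x"] by (simp add: T1_def f1_def)
  have sum_2: "(\<Sum>y\<in>S2. f2 y * k y) = f2 o2 * k o2 + (\<Sum>y\<in>T2. f (j2 y) * k y)" for k
    using sum.remove[OF fin(2) mem(2), of "\<lambda>y. f2 y * k y"] by (simp add: T2_def f2_def)
  have top: "f (j1 o1) = f1 o1 + f2 o2" using sum_S[of f] f by (simp add: f1_def f2_def)
  show thesis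
  proof (rule that[of S1 f1 S2 f2])
    show "sum f1 S1 = 0" using sum_1[of "\<lambda>_. 1"] by (simp add: f1_def)
    show "sum f2 S2 = 0" using sum_2[of "\<lambda>_. 1"] by (simp add: f2_def)
    show "(\<Sum>z\<in>S. f z * h z) = (\<Sum>x\<in>S1. f1 x * h (j1 x)) + (\<Sum>y\<in>S2. f2 y * h (j2 y))" for h
      unfolding sum_S sum_1 sum_2 top by (simp add: glued algebra_simps)
  qed (use fin mem top in \<open>auto simp: S1_def S2_def f1_def f2_def\<close>)
qed

text \<open>The mixed part of the form disappears: there the distance is a function of one argument
  plus a function of the other, and both functions have sum zero.\<close>

lemma wedge_split_form:
  fixes f :: "'c \<Rightarrow> real"
  assumes "finite S" "j1 o1 \<in> S" "S \<subseteq> verts W" "sum f S = 0"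
  obtains S1 S2 f1 f2 where "finite S1" "S1 \<subseteq> verts G1" "o1 \<in> S1" "sum f1 S1 = 0"
    and "finite S2" "S2 \<subseteq> verts G2" "o2 \<in> S2" "sum f2 S2 = 0"
    and "dist_form W S f = dist_form G1 S1 f1 + dist_form G2 S2 f2"
    and "(\<Sum>z\<in>S. (f z)\<^sup>2) = (\<Sum>x\<in>S1. (f1 x)\<^sup>2) + (\<Sum>y\<in>S2. (f2 y)\<^sup>2) + 2 * f1 o1 * f2 o2"
proof -
  obtain S1 S2 f1 f2 where 1: "finite S1" "S1 \<subseteq> verts G1" "o1 \<in> S1" "sum f1 S1 = 0"
    and 2: "finite S2" "S2 \<subseteq> verts G2" "o2 \<in> S2" "sum f2 S2 = 0"
    and f1: "\<And>x. x \<in> S1 \<Longrightarrow> x \<noteq> o1 \<Longrightarrow> f (j1 x) = f1 x"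
    and f2: "\<And>y. y \<in> S2 \<Longrightarrow> y \<noteq> o2 \<Longrightarrow> f (j2 y) = f2 y"
    and top: "f (j1 o1) = f1 o1 + f2 o2"
    and split: "\<And>h :: 'c \<Rightarrow> real. (\<Sum>z\<in>S. f z * h z) =
      (\<Sum>x\<in>S1. f1 x * h (j1 x)) + (\<Sum>y\<in>S2. f2 y * h (j2 y))"
    by (rule zero_sum_split[OF assms]) (rule that; assumption)
  let ?d = "\<lambda>z w. real (graph_dist W z w)"
  let ?d1 = "\<lambda>x u. real (graph_dist G1 x u)"
  let ?d2 = "\<lambda>y v. real (graph_dist G2 y v)"
  define c1 where "c1 = (\<Sum>x\<in>S1. f1 x * ?d1 x o1)"
  define c2 where "c2 = (\<Sum>y\<in>S2. f2 y * ?d2 y o2)"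
  have row1: "(\<Sum>w\<in>S. f w * ?d (j1 x) w) = (\<Sum>u\<in>S1. f1 u * ?d1 x u) + c2" if "x \<in> S1" for x
  proof -
    have "(\<Sum>y\<in>S2. f2 y * ?d (j1 x) (j2 y)) = (\<Sum>y\<in>S2. ?d1 x o1 * f2 y + f2 y * ?d2 y o2)"
      using that 1(2) 2(2) graph_dist_sym[of G2 o2]
      by (intro sum.cong) (auto simp: graph_dist_j1_j2 subset_iff algebra_simps)
    also have "\<dots> = c2" using 2(4) by (simp add: sum.distrib c2_def flip: sum_distrib_left)
    finally show ?thesis
      using that 1(2) unfolding split
      by (auto simp: graph_dist_j1_j1 subset_iff intro!: sum.cong)
  qed
  have row2: "(\<Sum>w\<in>S. f w * ?d (j2 y) w) = c1 + (\<Sum>v\<in>S2. f2 v * ?d2 y v)" if "y \<in> S2" for y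
  proof -
    have "(\<Sum>x\<in>S1. f1 x * ?d (j2 y) (j1 x)) = (\<Sum>x\<in>S1. ?d2 o2 y * f1 x + f1 x * ?d1 x o1)"
      using that 1(2) 2(2) graph_dist_sym[of W "j2 y"]
      by (intro sum.cong) (auto simp: graph_dist_j1_j2 subset_iff algebra_simps)
    also have "\<dots> = c1" using 1(4) by (simp add: sum.distrib c1_def flip: sum_distrib_left)
    finally show ?thesis
      using that 2(2) unfolding split
      by (auto simp: graph_dist_j2_j2 subset_iff intro!: sum.cong)
  qed
  have "dist_form W S f = (\<Sum>x\<in>S1. f1 x * ((\<Sum>u\<in>S1. f1 u * ?d1 x u) + c2)) +
      (\<Sum>y\<in>S2. f2 y * (c1 + (\<Sum>v\<in>S2. f2 v * ?d2 y v)))"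
    unfolding dist_form_def split[of "\<lambda>z. \<Sum>w\<in>S. f w * ?d z w"] using row1 row2 by simp
  also have "\<dots> = dist_form G1 S1 f1 + dist_form G2 S2 f2"
    using 1(4) 2(4)
    by (simp add: dist_form_def distrib_left sum.distrib flip: sum_distrib_right)
  finally have form: "dist_form W S f = dist_form G1 S1 f1 + dist_form G2 S2 f2" .
  \<comment> \<open>\<open>f \<circ> j1\<close> and \<open>f1\<close> differ on \<open>S1\<close> only at \<open>o1\<close>, by \<open>f2 o2\<close>.\<close>
  have "(\<Sum>x\<in>S1. f1 x * f (j1 x)) = (\<Sum>x\<in>S1. (f1 x)\<^sup>2) + f1 o1 * f2 o2"
    using f1 top
    by (simp add: sum.remove[OF 1(1,3)] power2_eq_square algebra_simps cong: sum.cong_simp)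
  moreover have "(\<Sum>y\<in>S2. f2 y * f (j2 y)) = (\<Sum>y\<in>S2. (f2 y)\<^sup>2) + f1 o1 * f2 o2"
    using f2 top
    by (simp add: sum.remove[OF 2(1,3)] glued power2_eq_square algebra_simps cong: sum.cong_simp)
  ultimately have "(\<Sum>z\<in>S. (f z)\<^sup>2) =
      (\<Sum>x\<in>S1. (f1 x)\<^sup>2) + (\<Sum>y\<in>S2. (f2 y)\<^sup>2) + 2 * f1 o1 * f2 o2"
    using split[of f] by (simp add: power2_eq_square)
  from that[OF 1 2 form this] show thesis .
qed

text \<open>The difference \<open>q N - (q1 N1 + q2 N2)\<close>, where \<open>N\<close> is the squared norm of the whole
  function, equals \<open>(q - q1) N1 + (q - q2) N2 + 2 q a b\<close>. Only the last term can be negative, and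
  the discriminant condition bounds it by twice the geometric mean of the first two.\<close>

lemma QEC_wedge_le:
  assumes Q1: "QEC G1 \<le> ereal q1" and Q2: "QEC G2 \<le> ereal q2"
    and q: "q1 \<le> q" "q2 \<le> q"
    and disc: "(1 - 1 / real (card (verts G1))) * (1 - 1 / real (card (verts G2))) * q\<^sup>2
      \<le> (q - q1) * (q - q2)"
  shows "QEC W \<le> ereal q"
proof (rule QEC_leI[of "{j1 o1}"])
  show "{j1 o1} \<subseteq> verts W" using verts_W o1 by auto
next
  fix S and f :: "'c \<Rightarrow> real"
  assume S: "finite S" "{j1 o1} \<subseteq> S" "S \<subseteq> verts W" and f: "sum f S = 0"
  have base: "j1 o1 \<in> S" using S(2) by simp
  obtain S1 S2 f1 f2 where 1: "finite S1" "S1 \<subseteq> verts G1" "o1 \<in> S1" "sum f1 S1 = 0"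
    and 2: "finite S2" "S2 \<subseteq> verts G2" "o2 \<in> S2" "sum f2 S2 = 0"
    and form: "dist_form W S f = dist_form G1 S1 f1 + dist_form G2 S2 f2"
    and norm: "(\<Sum>z\<in>S. (f z)\<^sup>2) =
      (\<Sum>x\<in>S1. (f1 x)\<^sup>2) + (\<Sum>y\<in>S2. (f2 y)\<^sup>2) + 2 * f1 o1 * f2 o2"
    by (rule wedge_split_form[OF S(1) base S(3) f]) (rule that; assumption)
  define N1 where "N1 = (\<Sum>x\<in>S1. (f1 x)\<^sup>2)"
  define N2 where "N2 = (\<Sum>y\<in>S2. (f2 y)\<^sup>2)"
  define a where "a = f1 o1"
  define b where "b = f2 o2"
  let ?c1 = "1 - 1 / real (card (verts G1))" and ?c2 = "1 - 1 / real (card (verts G2))"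
  have N: "N1 \<ge> 0" "N2 \<ge> 0" by (auto simp: N1_def N2_def sum_nonneg)
  have "a\<^sup>2 \<le> ?c1 * N1" "b\<^sup>2 \<le> ?c2 * N2"
    using zero_sum_point_le[OF 1] zero_sum_point_le[OF 2]
    by (simp_all add: a_def b_def N1_def N2_def)
  then have "a\<^sup>2 * b\<^sup>2 \<le> (?c1 * N1) * (?c2 * N2)"
    by (intro mult_mono) (auto intro: order_trans[OF zero_le_power2])
  then have "q\<^sup>2 * (a\<^sup>2 * b\<^sup>2) \<le> q\<^sup>2 * ((?c1 * N1) * (?c2 * N2))"
    by (rule mult_left_mono) simp
  also have "\<dots> = (?c1 * ?c2 * q\<^sup>2) * (N1 * N2)"
    by (simp only: mult.assoc mult.commute mult.left_commute)
  also have "\<dots> \<le> ((q - q1) * (q - q2)) * (N1 * N2)"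
    using disc N by (intro mult_right_mono) auto
  finally have ab: "(q * a * b)\<^sup>2 \<le> ((q - q1) * N1) * ((q - q2) * N2)"
    by (simp add: power_mult_distrib mult_ac)
  have "\<bar>2 * (q * a * b)\<bar> \<le> (q - q1) * N1 + (q - q2) * N2"
  proof (rule power2_le_imp_le)
    have amgm: "4 * (x * y) \<le> (x + y)\<^sup>2" for x y :: real
      using zero_le_power2[of "x - y"] by (simp add: power2_sum power2_diff)
    have "\<bar>2 * (q * a * b)\<bar>\<^sup>2 = 4 * (q * a * b)\<^sup>2"
      by (simp add: power_mult_distrib)
    also have "\<dots> \<le> 4 * (((q - q1) * N1) * ((q - q2) * N2))" using ab by simp
    also have "\<dots> \<le> ((q - q1) * N1 + (q - q2) * N2)\<^sup>2" by (rule amgm)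
    finally show "\<bar>2 * (q * a * b)\<bar>\<^sup>2 \<le> ((q - q1) * N1 + (q - q2) * N2)\<^sup>2" .
    show "0 \<le> (q - q1) * N1 + (q - q2) * N2" using q N by simp
  qed
  then have "q1 * N1 + q2 * N2 \<le> q * (N1 + N2 + 2 * a * b)"
    by (simp add: algebra_simps)
  moreover have "dist_form G1 S1 f1 \<le> q1 * N1" "dist_form G2 S2 f2 \<le> q2 * N2"
    using dist_form_le_QEC[OF Q1 1(1,2,4)] dist_form_le_QEC[OF Q2 2(1,2,4)]
    by (simp_all add: N1_def N2_def)
  ultimately show "dist_form W S f \<le> q * (\<Sum>z\<in>S. (f z)\<^sup>2)"
    using form norm by (simp add: N1_def N2_def a_def b_def)
qed simp

end

lemma star_product_wedge:
  assumes "connected_graph G1" "connected_graph G2" "o1 \<in> verts G1" "o2 \<in> verts G2"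
  shows "wedge G1 G2 (star_product G1 o1 G2 o2) o1 o2 Inl (\<lambda>y. glue o1 o2 (Inr y))"
proof
  have [simp]: "glue o1 o2 (Inl x) = Inl x" for x by (simp add: glue_def)
  show "edges (star_product G1 o1 G2 o2) =
      (`) Inl ` edges G1 \<union> (`) (\<lambda>y. glue o1 o2 (Inr y)) ` edges G2"
    by (simp add: star_product_def disjoint_union_def image_Un image_image)
  show "verts (star_product G1 o1 G2 o2) =
      Inl ` verts G1 \<union> (\<lambda>y. glue o1 o2 (Inr y)) ` verts G2"
    by (simp add: star_product_def disjoint_union_def image_Un image_image)
qed (use assms in \<open>auto simp: glue_def inj_on_def split: if_splits\<close>)


section \<open>The bound as a root of a quadratic equation\<close>

text \<open>The root of smaller absolute value of \<open>(1 - c) m\<^sup>2 - (q1 + q2) m + q1 q2 = 0\<close>, written with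
  a rationalised numerator so that it remains meaningful for \<open>c = 1\<close>, where the equation is
  linear; here \<open>q1\<close> and \<open>q2\<close> are negative and \<open>0 < c \<le> 1\<close>.\<close>

definition wedge_root :: "real \<Rightarrow> real \<Rightarrow> real \<Rightarrow> real" where
  "wedge_root q1 q2 c = 2 * q1 * q2 / (q1 + q2 - sqrt ((q1 + q2)\<^sup>2 - 4 * (1 - c) * q1 * q2))"

lemma wedge_root_disc:
  fixes q1 q2 c :: real
  shows "(q1 + q2)\<^sup>2 - 4 * (1 - c) * q1 * q2 = (q1 - q2)\<^sup>2 + 4 * c * (q1 * q2)"
  by (simp add: power2_eq_square algebra_simps)

lemma wedge_root_bounds:
  assumes q: "q1 < 0" "q2 < 0" and c: "0 < c"
  shows "q1 < wedge_root q1 q2 c" "q2 < wedge_root q1 q2 c" "wedge_root q1 q2 c < 0"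
proof -
  define r where "r = sqrt ((q1 + q2)\<^sup>2 - 4 * (1 - c) * q1 * q2)"
  have "q1 * q2 > 0" using q by (simp add: mult_neg_neg)
  then have "(q1 - q2)\<^sup>2 < (q1 + q2)\<^sup>2 - 4 * (1 - c) * q1 * q2"
    unfolding wedge_root_disc using c by simp
  then have "sqrt ((q1 - q2)\<^sup>2) < r" unfolding r_def by (rule real_sqrt_less_mono)
  then have r: "\<bar>q1 - q2\<bar> < r" by simp
  then have den: "q1 + q2 - r < 0" using q by linarith
  have eq: "wedge_root q1 q2 c = 2 * q1 * q2 / (q1 + q2 - r)" by (simp add: wedge_root_def r_def)
  show "wedge_root q1 q2 c < 0"
    unfolding eq using \<open>q1 * q2 > 0\<close> den by (simp add: divide_pos_neg mult.assoc)
  have "q1 * (2 * q2) < q1 * (q1 + q2 - r)"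
    by (rule mult_strict_left_mono_neg) (use r q in auto)
  then show "q1 < wedge_root q1 q2 c"
    unfolding eq using den by (simp add: less_divide_eq mult_ac)
  have "q2 * (2 * q1) < q2 * (q1 + q2 - r)"
    by (rule mult_strict_left_mono_neg) (use r q in auto)
  then show "q2 < wedge_root q1 q2 c"
    unfolding eq using den by (simp add: less_divide_eq mult_ac)
qed

lemma wedge_root_equation:
  assumes q: "q1 < 0" "q2 < 0" and c: "0 < c"
  defines "m \<equiv> wedge_root q1 q2 c"
  shows "(m - q1) * (m - q2) = c * m\<^sup>2"
proof -
  define r where "r = sqrt ((q1 + q2)\<^sup>2 - 4 * (1 - c) * q1 * q2)"
  define d where "d = q1 + q2 - r"
  have "q1 * q2 > 0" using q by (simp add: mult_neg_neg)
  then have r2: "r\<^sup>2 = (q1 + q2)\<^sup>2 - 4 * (1 - c) * q1 * q2"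
    unfolding r_def wedge_root_disc using c by simp
  have "r \<ge> 0" unfolding r_def wedge_root_disc using c \<open>q1 * q2 > 0\<close> by simp
  then have "d < 0" using q by (simp add: d_def)
  then have md: "m * d = 2 * (q1 * q2)"
    by (simp add: m_def wedge_root_def d_def r_def)
  have d2: "d\<^sup>2 = 2 * (q1 + q2) * d - 4 * (1 - c) * (q1 * q2)"
    using r2 by (simp add: d_def power2_eq_square algebra_simps)
  \<comment> \<open>Multiplying by \<open>d\<^sup>2\<close> clears the denominator of \<open>m\<close>; both \<open>m d\<close> and \<open>d\<^sup>2\<close> are then known.\<close>
  have "d\<^sup>2 * ((m - q1) * (m - q2) - c * m\<^sup>2)
      = (1 - c) * (m * d)\<^sup>2 - (q1 + q2) * d * (m * d) + q1 * q2 * d\<^sup>2"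
    by (simp add: power2_eq_square algebra_simps)
  also have "\<dots> = 0" unfolding md d2 by (simp add: power2_eq_square algebra_simps)
  finally show ?thesis using \<open>d < 0\<close> by simp
qed

lemma tendsto_wedge_root:
  assumes q: "q1 < 0" "q2 < 0" and c: "0 < c" and g: "(g \<longlongrightarrow> c) F"
  shows "((\<lambda>k. wedge_root q1 q2 (g k)) \<longlongrightarrow> wedge_root q1 q2 c) F"
proof -
  have "q1 * q2 > 0" using q by (simp add: mult_neg_neg)
  then have "sqrt ((q1 + q2)\<^sup>2 - 4 * (1 - c) * q1 * q2) \<ge> 0"
    unfolding wedge_root_disc using c by simp
  then have "q1 + q2 - sqrt ((q1 + q2)\<^sup>2 - 4 * (1 - c) * q1 * q2) \<noteq> 0" using q by linarith
  then show ?thesis unfolding wedge_root_def by (intro tendsto_intros g)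
qed

lemma Q12_finite_eq:
  "Q12_finite q1 q2 k1 k2 = wedge_root q1 q2 ((1 - 1 / real (k1 + 1)) * (1 - 1 / real (k2 + 1)))"
proof -
  have "4 * (a + b - 1) / (a * b) = 4 * (1 - (1 - 1 / a) * (1 - 1 / b))"
    if "a > 0" "b > 0" for a b :: real
    using that by (simp add: field_simps)
  from this[of "real k1 + 1" "real k2 + 1"]
  have "4 * (real k1 + real k2 + 1) / ((real k1 + 1) * (real k2 + 1))
      = 4 * (1 - (1 - 1 / real (k1 + 1)) * (1 - 1 / real (k2 + 1)))"
    by (simp add: add_ac)
  then show ?thesis unfolding Q12_finite_def wedge_root_def by simp
qed

text \<open>The limits for infinite graphs, taken by continuity of the root in \<open>c\<close>, amount to the
  convention \<open>1 / real (card V) = 0\<close>.\<close>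

lemma Q12_eq_wedge_root:
  assumes q: "q1 < 0" "q2 < 0"
    and V1: "ecard V1 = n1 + 1" "n1 + 1 \<ge> 2" and V2: "ecard V2 = n2 + 1" "n2 + 1 \<ge> 2"
  defines "c1 \<equiv> 1 - 1 / real (card V1)" and "c2 \<equiv> 1 - 1 / real (card V2)"
  shows "0 < c1" "0 < c2" "Q12 q1 q2 n1 n2 = wedge_root q1 q2 (c1 * c2)"
proof -
  have lim: "(\<lambda>k. 1 - 1 / real (k + 1)) \<longlonglongrightarrow> 1"
    using tendsto_diff[OF tendsto_const[of 1] LIMSEQ_Suc[OF lim_1_over_n]] by simp
  have fin: "card V = k + 1 \<and> k \<ge> 1" if "ecard V = enat k + 1" "enat k + 1 \<ge> 2"
    for V :: "'v set" and k
    using that by (auto simp: ecard_def one_enat_def numeral_eq_enat split: if_splits)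
  have inf: "card V = 0" if "ecard V = \<infinity> + 1" for V :: "'v set"
    using that by (auto simp: ecard_def one_enat_def split: if_splits)
  show c1: "0 < c1" using fin[of V1] inf[of V1] V1 by (cases n1) (auto simp: c1_def)
  show c2: "0 < c2" using fin[of V2] inf[of V2] V2 by (cases n2) (auto simp: c2_def)
  have c12: "0 < c1 * c2" using c1 c2 by (rule mult_pos_pos)
  show "Q12 q1 q2 n1 n2 = wedge_root q1 q2 (c1 * c2)"
  proof (cases n1)
    case n1: (enat k1)
    then have c1_eq: "c1 = 1 - 1 / real (k1 + 1)" using fin[of V1 k1] V1 by (simp add: c1_def)
    show ?thesis
    proof (cases n2)
      case n2: (enat k2)
      then have "c2 = 1 - 1 / real (k2 + 1)" using fin[of V2 k2] V2 by (simp add: c2_def)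
      then show ?thesis using n1 n2 c1_eq by (simp add: Q12_def Q12_finite_eq[abs_def])
    next
      case n2: infinity
      then have "c2 = 1" using inf[of V2] V2 by (simp add: c2_def)
      then have "(\<lambda>k. c1 * (1 - 1 / real (k + 1))) \<longlonglongrightarrow> c1 * c2"
        using tendsto_mult[OF tendsto_const lim, of c1] by simp
      from limI[OF tendsto_wedge_root[OF q c12 this]] show ?thesis
        using n1 n2 c1_eq by (simp add: Q12_def Q12_finite_eq[abs_def])
    qed
  next
    case n1: infinity
    then have c1_eq: "c1 = 1" using inf[of V1] V1 by (simp add: c1_def)
    show ?thesis
    proof (cases n2)
      case n2: (enat k2)
      then have c2_eq: "c2 = 1 - 1 / real (k2 + 1)" using fin[of V2 k2] V2 by (simp add: c2_def)
      have "(\<lambda>k. (1 - 1 / real (k + 1)) * c2) \<longlonglongrightarrow> c1 * c2"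
        using tendsto_mult[OF lim tendsto_const, of c2] c1_eq by simp
      from limI[OF tendsto_wedge_root[OF q c12 this]] show ?thesis
        using n1 n2 c2_eq by (simp add: Q12_def Q12_finite_eq[abs_def])
    next
      case n2: infinity
      then have c2_eq: "c2 = 1" using inf[of V2] V2 by (simp add: c2_def)
      have "wedge_root q1 q2 1 = q1 * q2 / (q1 + q2)"
        using q by (simp add: wedge_root_def field_simps)
      then show ?thesis using n1 n2 c1_eq c2_eq by (simp add: Q12_def)
    qed
  qed
qed

theorem corollary4p7:
  fixes G1 :: "'a ugraph" and G2 :: "'b ugraph"
    and o1 :: 'a and o2 :: 'b
    and n1 n2 :: enat and Q1 Q2 :: real
  assumes "connected_graph G1" and "connected_graph G2"
    and "ecard (verts G1) = n1 + 1" and "ecard (verts G2) = n2 + 1"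
    and "n1 + 1 \<ge> 2" and "n2 + 1 \<ge> 2"
    and "o1 \<in> verts G1" and "o2 \<in> verts G2"
    and "QE_class TYPE('h1::{real_inner, complete_space}) G1"
    and "QE_class TYPE('h2::{real_inner, complete_space}) G2"
    and "QEC G1 = ereal Q1" and "QEC G2 = ereal Q2"
    and "Q1 < 0" and "Q2 < 0"
  shows "ereal (max Q1 Q2) \<le> QEC (star_product G1 o1 G2 o2)
    \<and> QEC (star_product G1 o1 G2 o2) \<le> ereal (Q12 Q1 Q2 n1 n2)
    \<and> max Q1 Q2 < Q12 Q1 Q2 n1 n2
    \<and> Q12 Q1 Q2 n1 n2 < 0"
proof -
  interpret wedge G1 G2 "star_product G1 o1 G2 o2" o1 o2 Inl "\<lambda>y. glue o1 o2 (Inr y)"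
    using star_product_wedge assms(1,2,7,8) .
  let ?c1 = "1 - 1 / real (card (verts G1))" and ?c2 = "1 - 1 / real (card (verts G2))"
  let ?m = "Q12 Q1 Q2 n1 n2"
  note Q12 = Q12_eq_wedge_root[OF assms(13,14,3,5,4,6)]
  have c: "0 < ?c1 * ?c2" using Q12(1,2) by (rule mult_pos_pos)
  note bounds = wedge_root_bounds[OF assms(13,14) c, folded Q12(3)]
  have "QEC (star_product G1 o1 G2 o2) \<le> ereal ?m"
    using wedge_root_equation[OF assms(13,14) c, folded Q12(3)] bounds assms(11,12)
    by (intro QEC_wedge_le) auto
  moreover have "ereal Q1 \<le> QEC (star_product G1 o1 G2 o2)"
    using QEC_le_wedge assms(11) by simp
  moreover have "ereal Q2 \<le> QEC (star_product G1 o1 G2 o2)"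
    using wedge.QEC_le_wedge[OF swap] assms(12) by simp
  ultimately show ?thesis using bounds by (simp add: max_def)
qed

end
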